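(* There is an online algorithm (Algorithm 3) for submodular maximization subject to linear packing constraints which, without knowledge of $B$ or $d$, is $\Omega\!\left(\alpha d^{-\frac{2}{B-1}}\right)$-competitive whenever $B\ge2$: there is an absolute constant $c_0>0$ such that its integral output $y\in\{0,1\}^U$ satisfies $Ay\le b$ and $\mathbb{E}[F(y)]\ge (c_0\alpha d^{-\frac{2}{B-1}}-o(1))\,F^*$.
   Context: Linear packing setting. $U$ is a set of $n$ items; $A=(a_{i,j})\in\mathbb{R}_{\ge0}^{m\times U}$ and $b\in\mathbb{R}_{>0}^m$; w.l.o.g. $\max_j a_{i,j}\le1$ for each $i$. The capacity ratio is $B=\min_{i\in[m]} b_i/\max_{j} a_{i,j}$, and the column sparsity $d$ is the maximum number of nonzero entries in a column of $A$. $f\colon 2^U\to\mathbb{R}_{\ge0}$ is monotone submodular with multilinear extension $F(x)=\sum_{R\subseteq U}f(R)\prod_{i\in R}x_i\prod_{i\in U\setminus R}(1-x_i)$, $x\in[0,1]^U$, and $F^*=\sup\{F(x):x\in[0,1]^U,Ax\le b\}$. Items arrive one per round in uniformly random order; the column of item $j$ is revealed on arrival and the algorithm must immediately and irrevocably set $y_j\in\{0,1\}$, keeping $Ay\le b$. $f$ is known on subsets of arrived items. For $S\subseteq U$, $\mathcal{P}(\frac{\ell}{n},S)=\{x\in[0,1]^U: Ax\le\frac{\ell}{n}b,\ x_i=0\ \forall i\notin S\}$; the algorithm has access to an oracle $\mathcal{A}_F$ returning, for each such polytope $P$, a point $\mathcal{A}_F(P)\in P$ with $F(\mathcal{A}_F(P))\ge\alpha\sup_{x\in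 P}F(x)$, $\alpha\in(0,1]$. Algorithm 3: start with $x=0$, $S=\emptyset$; in round $\ell$, when item $j$ arrives, set $S:=S\cup\{j\}$, compute $\tilde x^{(\ell)}=\mathcal{A}_F(\mathcal{P}(\frac{\ell}{n},S))$, let $\hat x^{(\ell)}$ be $e_j$ with probability $\tilde x^{(\ell)}_j$ and $0$ otherwise; if $A(x+\hat x^{(\ell)})\le b$ set $x:=x+\hat x^{(\ell)}$; output $y=x$. *)

theory Defs
  imports "HOL-Probability.Probability" "HOL-Combinatorics.Multiset_Permutations"
begin

text \<open>Items are natural numbers (ground set U, finite), constraint rows are
  indexed by natural numbers i < m.  A vector x in R^U is a function nat => real
  (only its values on U matter).\<close>

definition monotone_set_fn :: "nat set \<Rightarrow> (nat set \<Rightarrow> real) \<Rightarrow> bool" where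
  "monotone_set_fn U f \<longleftrightarrow> (\<forall>S T. S \<subseteq> T \<and> T \<subseteq> U \<longrightarrow> f S \<le> f T)"

definition submodular_set_fn :: "nat set \<Rightarrow> (nat set \<Rightarrow> real) \<Rightarrow> bool" where
  "submodular_set_fn U f \<longleftrightarrow>
     (\<forall>S T. S \<subseteq> U \<and> T \<subseteq> U \<longrightarrow> f (S \<union> T) + f (S \<inter> T) \<le> f S + f T)"

definition multilinear_ext :: "nat set \<Rightarrow> (nat set \<Rightarrow> real) \<Rightarrow> (nat \<Rightarrow> real) \<Rightarrow> real" where
  "multilinear_ext U f x = (\<Sum>R\<in>Pow U. f R * (\<Prod>i\<in>R. x i) * (\<Prod>i\<in>U - R. 1 - x i))"

definition Ax :: "nat set \<Rightarrow> (nat \<Rightarrow> nat \<Rightarrow> real) \<Rightarrow> (nat \<Rightarrow> real) \<Rightarrow> nat \<Rightarrow> real" where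
  "Ax U a x i = (\<Sum>j\<in>U. a i j * x j)"

definition cap_ratio :: "nat set \<Rightarrow> nat \<Rightarrow> (nat \<Rightarrow> nat \<Rightarrow> real) \<Rightarrow> (nat \<Rightarrow> real) \<Rightarrow> real" where
  "cap_ratio U m a b = Min ((\<lambda>i. b i / Max ((\<lambda>j. a i j) ` U)) ` {..<m})"

definition col_sparsity :: "nat set \<Rightarrow> nat \<Rightarrow> (nat \<Rightarrow> nat \<Rightarrow> real) \<Rightarrow> nat" where
  "col_sparsity U m a = Max ((\<lambda>j. card {i. i < m \<and> a i j \<noteq> 0}) ` U)"

definition unit_box :: "nat set \<Rightarrow> (nat \<Rightarrow> real) set" where
  "unit_box U = {x. (\<forall>i\<in>U. 0 \<le> x i \<and> x i \<le> 1) \<and> (\<forall>i. i \<notin> U \<longrightarrow> x i = 0)}"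

definition opt_frac :: "nat set \<Rightarrow> (nat set \<Rightarrow> real) \<Rightarrow> nat \<Rightarrow> (nat \<Rightarrow> nat \<Rightarrow> real)
    \<Rightarrow> (nat \<Rightarrow> real) \<Rightarrow> real" where
  "opt_frac U f m a b =
     Sup (multilinear_ext U f ` {x \<in> unit_box U. \<forall>i<m. Ax U a x i \<le> b i})"

definition scaled_poly :: "nat set \<Rightarrow> nat \<Rightarrow> (nat \<Rightarrow> nat \<Rightarrow> real) \<Rightarrow> (nat \<Rightarrow> real)
    \<Rightarrow> nat \<Rightarrow> nat set \<Rightarrow> (nat \<Rightarrow> real) set" where
  "scaled_poly U m a b l S =
     {x \<in> unit_box U. (\<forall>i<m. Ax U a x i \<le> (real l / real (card U)) * b i)
                     \<and> (\<forall>i. i \<notin> S \<longrightarrow> x i = 0)}"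

text \<open>Algorithm 3, run on the remaining arrival sequence js; l is the index of the
  current round (1-based), x is the current solution and S the set of arrived items.
  The oracle orc maps a polytope to a point of it.\<close>
fun alg3_run :: "nat set \<Rightarrow> nat \<Rightarrow> (nat \<Rightarrow> nat \<Rightarrow> real) \<Rightarrow> (nat \<Rightarrow> real)
    \<Rightarrow> ((nat \<Rightarrow> real) set \<Rightarrow> (nat \<Rightarrow> real))
    \<Rightarrow> nat \<Rightarrow> nat list \<Rightarrow> (nat \<Rightarrow> real) \<Rightarrow> nat set \<Rightarrow> (nat \<Rightarrow> real) pmf" where
  "alg3_run U m a b orc l [] x S = return_pmf x"
| "alg3_run U m a b orc l (j # js) x S =
     (let S' = insert j S;
          xt = orc (scaled_poly U m a b l S')
      in bind_pmf (bernoulli_pmf (xt j)) (\<lambda>c.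
           let xh = (if c then indicator {j} else (\<lambda>_. 0));
               x' = (if (\<forall>i<m. Ax U a (\<lambda>k. x k + xh k) i \<le> b i)
                     then (\<lambda>k. x k + xh k) else x)
           in alg3_run U m a b orc (Suc l) js x' S'))"

definition alg3 :: "nat set \<Rightarrow> nat \<Rightarrow> (nat \<Rightarrow> nat \<Rightarrow> real) \<Rightarrow> (nat \<Rightarrow> real)
    \<Rightarrow> ((nat \<Rightarrow> real) set \<Rightarrow> (nat \<Rightarrow> real)) \<Rightarrow> (nat \<Rightarrow> real) pmf" where
  "alg3 U m a b orc =
     bind_pmf (pmf_of_set (permutations_of_set U)) (\<lambda>\<sigma>. alg3_run U m a b orc 1 \<sigma> (\<lambda>_. 0) {})"

end

theory Submission
  imports Defs
begin

text \<open>
  Reveal the random order backwards. Given the set \<open>S\<close> of the first \<open>l\<close> items and everything that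
  happens after round \<open>l\<close>, the item of round \<open>l\<close> is uniform in \<open>S\<close>, so tentatively taking it raises
  the value of the items \<open>T\<close> taken later by at least \<open>(F x - f T) / l\<close> in expectation, where \<open>x\<close> is
  the point that the oracle returns for \<open>S\<close>. On average, \<open>F x\<close> is at least \<open>\<alpha> (l/n)\<^sup>2\<close> times the
  optimum: one factor \<open>l/n\<close> comes from restricting the optimum to \<open>S\<close>, the other from scaling it into
  the shrunken polytope.
  Whatever the later rounds are, each earlier round consumes at most \<open>b i / n\<close> of row \<open>i\<close> in
  expectation. Hence a Chernoff bound, together with a union bound over the at most \<open>d\<close> rows of the
  item, lets it fit with probability at least \<open>1/2\<close> during the first \<open>\<delta> n\<close> rounds, for
  \<open>\<delta> = d powr (- 1 / (B - 1)) / 12\<close>. These rounds alone yield a constant times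
  \<open>\<alpha> \<delta>\<^sup>2\<close> times the optimum; if \<open>\<delta> n < 2\<close>, this is absorbed by the error term \<open>1 / n\<^sup>2\<close>.
\<close>

subsection \<open>Multilinear extensions\<close>

lemma multilinear_ext_empty [simp]: "multilinear_ext {} f x = f {}"
  by (simp add: multilinear_ext_def)

text \<open>Condition on whether \<open>j\<close> belongs to the random set drawn from
  \<open>x\<close>. This recursion drives every induction on the ground set below.\<close>

lemma multilinear_ext_insert:
  assumes V: "finite V" and j: "j \<notin> V"
  shows "multilinear_ext (insert j V) f x =
    x j * multilinear_ext V (\<lambda>R. f (insert j R)) x + (1 - x j) * multilinear_ext V f x"
proof -
  let ?t = "\<lambda>R. f R * (\<Prod>i\<in>R. x i) * (\<Prod>i\<in>insert j V - R. 1 - x i)"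
  have disj: "Pow V \<inter> insert j ` Pow V = {}" using j by auto
  have inj: "inj_on (insert j) (Pow V)" using j by (auto simp: inj_on_def)
  have 1: "?t R = (1 - x j) * (f R * (\<Prod>i\<in>R. x i) * (\<Prod>i\<in>V - R. 1 - x i))" if "R \<in> Pow V" for R
  proof -
    have "insert j V - R = insert j (V - R)" using that j by auto
    then show ?thesis using V j by simp
  qed
  have 2: "?t (insert j R) = x j * (f (insert j R) * (\<Prod>i\<in>R. x i) * (\<Prod>i\<in>V - R. 1 - x i))"
    if "R \<in> Pow V" for R
  proof -
    have "insert j V - insert j R = V - R" using that j by auto
    moreover have "finite R" "j \<notin> R" using that V j by (auto intro: finite_subset)
    ultimately show ?thesis by simp
  qed
  have "multilinear_ext (insert j V) f x = sum ?t (Pow V) + sum ?t (insert j ` Pow V)"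
    unfolding multilinear_ext_def Pow_insert using V disj by (subst sum.union_disjoint) auto
  also have "sum ?t (insert j ` Pow V) = (\<Sum>R\<in>Pow V. ?t (insert j R))"
    using inj by (simp add: sum.reindex)
  finally show ?thesis
    unfolding multilinear_ext_def sum_distrib_left
    using sum.cong[OF refl 1, of "Pow V" "\<lambda>R. R"] sum.cong[OF refl 2, of "Pow V" "\<lambda>R. R"]
    by simp
qed

lemma multilinear_ext_mono:
  assumes "\<And>i. i \<in> V \<Longrightarrow> 0 \<le> x i \<and> x i \<le> 1" and "\<And>R. R \<subseteq> V \<Longrightarrow> f R \<le> g R"
  shows "multilinear_ext V f x \<le> multilinear_ext V g x"
  unfolding multilinear_ext_def
proof (rule sum_mono)
  fix R assume R: "R \<in> Pow V"
  have "0 \<le> (\<Prod>i\<in>R. x i)" "0 \<le> (\<Prod>i\<in>V - R. 1 - x i)"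
    using assms(1) R by (auto intro!: prod_nonneg)
  then show "f R * (\<Prod>i\<in>R. x i) * (\<Prod>i\<in>V - R. 1 - x i)
      \<le> g R * (\<Prod>i\<in>R. x i) * (\<Prod>i\<in>V - R. 1 - x i)"
    using assms(2) R by (intro mult_right_mono) auto
qed

lemma multilinear_ext_sum:
  "multilinear_ext V (\<lambda>R. \<Sum>k\<in>K. f k R) x = (\<Sum>k\<in>K. multilinear_ext V (f k) x)"
  unfolding multilinear_ext_def sum_distrib_right by (rule sum.swap)

lemma multilinear_ext_diff:
  "multilinear_ext V (\<lambda>R. f R - g R) x = multilinear_ext V f x - multilinear_ext V g x"
  by (simp add: multilinear_ext_def sum_subtractf algebra_simps)

lemma multilinear_ext_cmult:
  "multilinear_ext V (\<lambda>R. c * f R) x = c * multilinear_ext V f x"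
  by (simp add: multilinear_ext_def sum_distrib_left algebra_simps)

text \<open>Linearity of expectation. The constant \<open>c\<close> must vary in the induction,
  since taking \<open>j\<close> turns it into \<open>c + w j\<close>.\<close>

lemma multilinear_ext_linear:
  assumes "finite V"
  shows "multilinear_ext V (\<lambda>R. c + (\<Sum>j\<in>R. w j)) x = c + (\<Sum>j\<in>V. x j * w j)"
  using assms
proof (induction V arbitrary: c)
  case (insert j V)
  have "multilinear_ext V (\<lambda>R. c + sum w (insert j R)) x
      = multilinear_ext V (\<lambda>R. (c + w j) + sum w R) x"
    unfolding multilinear_ext_def
    using insert by (intro sum.cong) (auto simp: finite_subset subset_iff intro!: sum.insert)
  also have "\<dots> = c + w j + (\<Sum>j\<in>V. x j * w j)" by (rule insert.IH)
  finally show ?case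
    using insert.hyps insert.IH[of c] by (simp add: multilinear_ext_insert algebra_simps)
qed simp

lemma multilinear_ext_const: "finite V \<Longrightarrow> multilinear_ext V (\<lambda>R. c) x = c"
  using multilinear_ext_linear[of V c "\<lambda>_. 0"] by simp

text \<open>Zeroing coordinates outside \<open>S\<close> intersects the random set with
  \<open>S\<close>. Thus inequalities about sets \<open>R \<inter> S\<close>, once shown for each
  \<open>R\<close>, carry over to restricted points.\<close>

lemma multilinear_ext_restrict:
  assumes "finite V"
  shows "multilinear_ext V f (\<lambda>k. if k \<in> S then x k else 0) = multilinear_ext V (\<lambda>R. f (R \<inter> S)) x"
  using assms
proof (induction V arbitrary: f)
  case (insert j V)
  then show ?case
    by (cases "j \<in> S") (simp_all add: multilinear_ext_insert Int_insert_left algebra_simps)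
qed simp

lemma multilinear_ext_zero_one:
  assumes "finite V" "\<And>k. k \<in> V \<Longrightarrow> x k = 0 \<or> x k = 1"
  shows "multilinear_ext V f x = f {k \<in> V. x k = 1}"
  using assms
proof (induction V arbitrary: f)
  case (insert j V)
  have "x j = 0 \<or> x j = 1" using insert by auto
  moreover have "x j = 1 \<Longrightarrow> {k \<in> insert j V. x k = 1} = insert j {k \<in> V. x k = 1}"
    "x j = 0 \<Longrightarrow> {k \<in> insert j V. x k = 1} = {k \<in> V. x k = 1}" by auto
  ultimately show ?case
    using insert.hyps insert.IH insert.prems by (elim disjE) (simp_all add: multilinear_ext_insert)
qed simp

section \<open>Submodularity: concavity along rays, marginals and removals\<close>

lemma submodular_set_fnD:
  "submodular_set_fn U f \<Longrightarrow> S \<subseteq> U \<Longrightarrow> T \<subseteq> U \<Longrightarrow>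
    f (S \<union> T) + f (S \<inter> T) \<le> f S + f T"
  by (simp add: submodular_set_fn_def)

lemma monotone_set_fnD: "monotone_set_fn U f \<Longrightarrow> S \<subseteq> T \<Longrightarrow> T \<subseteq> U \<Longrightarrow> f S \<le> f T"
  by (simp add: monotone_set_fn_def)

lemma submodular_insert:
  assumes "submodular_set_fn U f" "S \<subseteq> T" "T \<subseteq> U" "j \<in> U" "j \<notin> T"
  shows "f (insert j T) - f T \<le> f (insert j S) - f S"
proof -
  have "f (insert j S \<union> T) + f (insert j S \<inter> T) \<le> f (insert j S) + f T"
    using assms unfolding submodular_set_fn_def by (meson insert_subset subset_trans)
  moreover have "insert j S \<union> T = insert j T" "insert j S \<inter> T = S" using assms by auto
  ultimately show ?thesis by simp
qed

text \<open>Chord form of the concavity of the extension along rays from the origin. The induction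
  treats \<open>f\<close> and \<open>f\<close> with \<open>j\<close> added, both submodular on
  \<open>V\<close>, separately.\<close>

lemma multilinear_ext_scale:
  assumes "finite V" "submodular_set_fn V f" "0 \<le> c" "c \<le> 1"
    and "\<And>i. i \<in> V \<Longrightarrow> 0 \<le> x i \<and> x i \<le> 1"
  shows "c * multilinear_ext V f x + (1 - c) * f {} \<le> multilinear_ext V f (\<lambda>k. c * x k)"
  using assms
proof (induction V arbitrary: f)
  case (insert j V)
  let ?fj = "\<lambda>R. f (insert j R)"
  have sub: "submodular_set_fn V f"
    using insert.prems(1) unfolding submodular_set_fn_def by blast
  have subj: "submodular_set_fn V ?fj"
    unfolding submodular_set_fn_def
  proof (intro allI impI)
    fix S T assume "S \<subseteq> V \<and> T \<subseteq> V"
    then have "f (insert j S \<union> insert j T) + f (insert j S \<inter> insert j T)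
        \<le> f (insert j S) + f (insert j T)"
      by (intro submodular_set_fnD[OF insert.prems(1)]) auto
    then show "f (insert j (S \<union> T)) + f (insert j (S \<inter> T)) \<le> f (insert j S) + f (insert j T)"
      by simp
  qed
  have xV: "\<And>i. i \<in> V \<Longrightarrow> 0 \<le> x i \<and> x i \<le> 1" and xj: "0 \<le> x j" "x j \<le> 1"
    using insert.prems by auto
  define A where "A = multilinear_ext V ?fj x"
  define C where "C = multilinear_ext V f x"
  define A' where "A' = multilinear_ext V ?fj (\<lambda>k. c * x k)"
  define C' where "C' = multilinear_ext V f (\<lambda>k. c * x k)"
  have IH: "c * A + (1 - c) * f {j} \<le> A'" "c * C + (1 - c) * f {} \<le> C'"
    using insert.IH[OF sub] insert.IH[OF subj] insert.prems xV
    by (simp_all add: A_def C_def A'_def C'_def)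
  \<comment> \<open>By diminishing returns the expected marginal of \<open>j\<close> is at most its
    marginal at the empty set; this is the sign needed for the error term of the identity that
    follows.\<close>
  have "multilinear_ext V (\<lambda>R. ?fj R - f R) x \<le> multilinear_ext V (\<lambda>R. f {j} - f {}) x"
    using submodular_insert[OF insert.prems(1), of "{}" _ j] insert.hyps
    by (intro multilinear_ext_mono xV) auto
  then have marg: "0 \<le> f {j} - f {} - A + C"
    using insert.hyps by (simp add: multilinear_ext_diff multilinear_ext_const A_def C_def)
  have cx: "0 \<le> c * x j" "c * x j \<le> 1"
    using insert.prems xj by (auto intro: mult_le_one)
  have "c * (x j * A + (1 - x j) * C) + (1 - c) * f {}
      = c * x j * (c * A + (1 - c) * f {j}) + (1 - c * x j) * (c * C + (1 - c) * f {})
        - c * x j * (1 - c) * (f {j} - f {} - A + C)"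
    by (simp add: algebra_simps)
  also have "\<dots> \<le> c * x j * (c * A + (1 - c) * f {j}) + (1 - c * x j) * (c * C + (1 - c) * f {})"
    using marg cx insert.prems by simp
  also have "\<dots> \<le> c * x j * A' + (1 - c * x j) * C'"
    using IH cx by (intro add_mono mult_left_mono) auto
  finally show ?case
    using insert.hyps by (simp add: multilinear_ext_insert A_def C_def A'_def C'_def)
qed (simp add: algebra_simps)

text \<open>For each \<open>R\<close>, monotonicity gives \<open>f R \<le> f (R \<union> T)\<close>,
  and diminishing returns bound the latter by \<open>f T\<close> plus the marginals over
  \<open>T\<close> of the items of \<open>R\<close>. Averaging over \<open>R\<close> drawn from
  \<open>x\<close> gives the claim.\<close>

lemma multilinear_ext_le_marginals:
  assumes U: "finite U" "monotone_set_fn U f" "submodular_set_fn U f" "T \<subseteq> U"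
    and x: "\<And>i. i \<in> U \<Longrightarrow> 0 \<le> x i \<and> x i \<le> 1"
  shows "multilinear_ext U f x \<le> f T + (\<Sum>j\<in>U. x j * (f (insert j T) - f T))"
proof -
  have "f R \<le> f T + (\<Sum>j\<in>R. f (insert j T) - f T)" if R: "R \<subseteq> U" for R
  proof -
    have "f (R \<union> T) \<le> f T + (\<Sum>j\<in>R. f (insert j T) - f T)"
      using finite_subset[OF R U(1)] R
    proof (induction R)
      case (insert j R)
      show ?case
      proof (cases "j \<in> R \<union> T")
        case True
        then have "insert j R \<union> T = R \<union> T" "insert j T = T" using insert by auto
        then show ?thesis using insert by simp
      next
        case False
        then show ?thesis
          using insert submodular_insert[OF U(3), of T "R \<union> T" j] U(4) by simp
      qed
    qed simp
    moreover have "f R \<le> f (R \<union> T)" using U R unfolding monotone_set_fn_def by simp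
    ultimately show ?thesis by simp
  qed
  then have "multilinear_ext U f x
      \<le> multilinear_ext U (\<lambda>R. f T + (\<Sum>j\<in>R. f (insert j T) - f T)) x"
    by (intro multilinear_ext_mono x)
  then show ?thesis using U by (simp add: multilinear_ext_linear)
qed

text \<open>Build \<open>A\<close> up one element at a time: a new \<open>a\<close> contributes the
  increment \<open>f (insert a A) - f A\<close>, and it can only lower the removal losses of the
  older elements. The increments telescope.\<close>

lemma sum_removals_le:
  assumes "submodular_set_fn U f" "A \<subseteq> U" "finite A"
  shows "(\<Sum>j\<in>A. f A - f (A - {j})) \<le> f A - f {}"
  using assms(3,2)
proof (induction A)
  case (insert a A)
  have "f (insert a A) - f (insert a A - {j}) \<le> f A - f (A - {j})" if j: "j \<in> A" for j
  proof -
    have "insert a A - {j} = insert a (A - {j})" using insert j by auto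
    then show ?thesis
      using submodular_insert[OF assms(1), of "A - {j}" A a] insert by auto
  qed
  then have "(\<Sum>j\<in>A. f (insert a A) - f (insert a A - {j})) \<le> (\<Sum>j\<in>A. f A - f (A - {j}))"
    by (rule sum_mono)
  moreover have "insert a A - {a} = A" using insert by auto
  ultimately show ?case using insert by simp
qed simp

text \<open>Deleting a uniformly random item of \<open>S\<close> preserves on average at least a
  fraction \<open>1 - 1 / card S\<close> of the value, already for each fixed set
  \<open>R\<close>.\<close>

lemma multilinear_ext_restrict_removals:
  assumes U: "finite U" "submodular_set_fn U f" "0 \<le> f {}" "S \<subseteq> U"
    and x: "\<And>i. i \<in> U \<Longrightarrow> 0 \<le> x i \<and> x i \<le> 1"
  shows "(real (card S) - 1) * multilinear_ext U f (\<lambda>k. if k \<in> S then x k else 0)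
    \<le> (\<Sum>j\<in>S. multilinear_ext U f (\<lambda>k. if k \<in> S - {j} then x k else 0))"
proof -
  have finS: "finite S" using U finite_subset by blast
  have "(real (card S) - 1) * f (R \<inter> S) \<le> (\<Sum>j\<in>S. f (R \<inter> (S - {j})))" if R: "R \<subseteq> U" for R
  proof -
    \<comment> \<open>Removing an item outside \<open>R\<close> loses nothing, so only
      \<open>R \<inter> S\<close> counts.\<close>
    have "(\<Sum>j\<in>S. f (R \<inter> S) - f (R \<inter> (S - {j})))
        = (\<Sum>j\<in>R \<inter> S. f (R \<inter> S) - f (R \<inter> (S - {j})))"
      by (rule sum.mono_neutral_right) (use finS in \<open>auto intro!: arg_cong[of _ _ f]\<close>)
    also have "\<dots> = (\<Sum>j\<in>R \<inter> S. f (R \<inter> S) - f (R \<inter> S - {j}))"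
      by (simp add: Int_Diff)
    also have "\<dots> \<le> f (R \<inter> S)"
      using sum_removals_le[OF U(2), of "R \<inter> S"] le_infI1[OF R, of S] U(3) finS by simp
    finally show ?thesis by (simp add: sum_subtractf algebra_simps)
  qed
  then have "multilinear_ext U (\<lambda>R. (real (card S) - 1) * f (R \<inter> S)) x
      \<le> multilinear_ext U (\<lambda>R. \<Sum>j\<in>S. f (R \<inter> (S - {j}))) x"
    by (intro multilinear_ext_mono x)
  then show ?thesis
    using U by (simp only: multilinear_ext_restrict multilinear_ext_cmult multilinear_ext_sum)
qed

subsection \<open>The algorithm in a backwards revealed order\<close>

text \<open>The chord of the convex \<open>exp\<close> lies above it. The bound is linear in the
  item size \<open>t\<close>, so a linear packing constraint can later be summed into it.\<close>

lemma exp_mult_le_linear: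
  fixes t c :: real
  assumes "0 \<le> t" "t \<le> 1"
  shows "exp (c * t) \<le> 1 + t * (exp c - 1)"
  using convex_onD[OF exp_convex, of t 0 c] assms by (simp add: algebra_simps)

lemma expectation_bind_finite:
  fixes h :: "'b \<Rightarrow> real"
  assumes "finite (set_pmf p)" "\<And>x. x \<in> set_pmf p \<Longrightarrow> finite (set_pmf (f x))"
  shows "measure_pmf.expectation (p \<bind> f) h
    = measure_pmf.expectation p (\<lambda>x. measure_pmf.expectation (f x) h)"
  using assms by (subst pmf_expectation_bind[of "set_pmf p"])
    (auto simp: integral_measure_pmf[of "set_pmf p"])

lemma expectation_mono_finite:
  fixes g h :: "'a \<Rightarrow> real"
  assumes "finite (set_pmf p)" "\<And>x. x \<in> set_pmf p \<Longrightarrow> g x \<le> h x"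
  shows "measure_pmf.expectation p g \<le> measure_pmf.expectation p h"
  using assms by (intro integral_mono_AE integrable_measure_pmf_finite) (auto simp: AE_measure_pmf_iff)

lemma Ax_add_indicator:
  assumes "finite U" "j \<in> U"
  shows "Ax U a (\<lambda>k. x k + indicator {j} k) i = Ax U a x i + a i j"
proof -
  have "(\<Sum>k\<in>U. a i k * indicator {j} k) = a i j"
    using assms by (simp add: indicator_def if_distrib[of "\<lambda>t. a i _ * t"] cong: if_cong)
  then show ?thesis by (simp add: Ax_def distrib_left sum.distrib)
qed

locale online_packing =
  fixes U :: "nat set" and m :: nat and a :: "nat \<Rightarrow> nat \<Rightarrow> real" and b :: "nat \<Rightarrow> real"
    and f :: "nat set \<Rightarrow> real" and \<alpha> :: real and orc :: "(nat \<Rightarrow> real) set \<Rightarrow> nat \<Rightarrow> real"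
  assumes finite_U: "finite U" and U_nonempty: "U \<noteq> {}" and m_pos: "0 < m"
    and a_nonneg: "\<And>i j. i < m \<Longrightarrow> j \<in> U \<Longrightarrow> 0 \<le> a i j"
    and row_nonzero: "\<And>i. i < m \<Longrightarrow> \<exists>j\<in>U. a i j \<noteq> 0"
    and b_pos: "\<And>i. i < m \<Longrightarrow> 0 < b i"
    and f_nonneg: "\<And>S. S \<subseteq> U \<Longrightarrow> 0 \<le> f S"
    and f_mono: "monotone_set_fn U f" and f_submodular: "submodular_set_fn U f"
    and \<alpha>_pos: "0 < \<alpha>"
    and orc_mem: "\<And>l S. 1 \<le> l \<Longrightarrow> l \<le> card U \<Longrightarrow> S \<subseteq> U \<Longrightarrow>
      orc (scaled_poly U m a b l S) \<in> scaled_poly U m a b l S"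
    and orc_approx: "\<And>l S. 1 \<le> l \<Longrightarrow> l \<le> card U \<Longrightarrow> S \<subseteq> U \<Longrightarrow>
      multilinear_ext U f (orc (scaled_poly U m a b l S))
        \<ge> \<alpha> * Sup (multilinear_ext U f ` scaled_poly U m a b l S)"
    and cap_ratio_ge: "cap_ratio U m a b \<ge> 2"
begin

abbreviation "n \<equiv> card U"
abbreviation "F \<equiv> multilinear_ext U f"

definition fits :: "nat \<Rightarrow> (nat \<Rightarrow> real) \<Rightarrow> bool" where
  "fits j x \<longleftrightarrow> (\<forall>i<m. Ax U a (\<lambda>k. x k + indicator {j} k) i \<le> b i)"

definition add_item :: "nat \<Rightarrow> (nat \<Rightarrow> real) \<Rightarrow> nat \<Rightarrow> real" where
  "add_item j x = (if fits j x then (\<lambda>k. x k + indicator {j} k) else x)"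

text \<open>The point computed in round \<open>card S\<close> depends on the set of arrived items
  only, not on their order; this makes a recursion over sets possible.\<close>

definition xt :: "nat set \<Rightarrow> nat \<Rightarrow> real" where
  "xt S = orc (scaled_poly U m a b (card S) S)"

definition alg_step :: "nat set \<Rightarrow> nat \<Rightarrow> (nat \<Rightarrow> real) \<Rightarrow> (nat \<Rightarrow> real) pmf" where
  "alg_step S j x = bind_pmf (bernoulli_pmf (xt S j))
     (\<lambda>c. return_pmf (if c then add_item j x else x))"

text \<open>
  The solution after the items of \<open>S\<close> have arrived, in random order, as the first \<open>card S\<close> items
  of \<open>U\<close>.
\<close>
definition D :: "nat set \<Rightarrow> (nat \<Rightarrow> real) pmf" where
  "D S = bind_pmf (pmf_of_set (permutations_of_set S))
     (\<lambda>\<sigma>. alg3_run U m a b orc 1 \<sigma> (\<lambda>_. 0) {})"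

abbreviation E :: "nat set \<Rightarrow> ((nat \<Rightarrow> real) \<Rightarrow> real) \<Rightarrow> real" where
  "E S \<equiv> measure_pmf.expectation (D S)"

section \<open>Recursion over the set of arrived items\<close>

lemma n_pos: "0 < n"
  using finite_U U_nonempty by (simp add: card_gt_0_iff)

lemma alg3_run_snoc:
  "alg3_run U m a b orc l (xs @ [j]) x S =
    bind_pmf (alg3_run U m a b orc l xs x S)
      (\<lambda>x'. alg3_run U m a b orc (l + length xs) [j] x' (S \<union> set xs))"
proof (induction xs arbitrary: l x S)
  case Nil
  show ?case by (simp only: append_Nil alg3_run.simps(1) bind_return_pmf) simp
next
  case (Cons k xs)
  have "insert k S \<union> set xs = S \<union> set (k # xs)" by auto
  then show ?case
    by (simp add: Let_def bind_assoc_pmf Cons.IH del: alg3_run.simps(1))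
qed

text \<open>When the coin yields 0, both outcomes of the feasibility test return \<open>x\<close>;
  hence \<open>alg_step\<close> tests only in the other case.\<close>

lemma alg3_run_single:
  assumes "S = insert j S'" "l = card S"
  shows "alg3_run U m a b orc l [j] x S' = alg_step S j x"
  unfolding alg_step_def xt_def using assms
  by (auto intro!: bind_pmf_cong simp: Let_def add_item_def fits_def)

lemma D_empty: "D {} = return_pmf (\<lambda>_. 0)"
  by (simp add: D_def pmf_of_set_singleton bind_return_pmf)

text \<open>\<open>random_permutation_of_set\<close> draws the head of the list first, whereas the
  analysis conditions on the last arrival.\<close>

lemma rev_random_permutation:
  "finite A \<Longrightarrow> map_pmf rev (pmf_of_set (permutations_of_set A)) = pmf_of_set (permutations_of_set A)"
proof -
  assume A: "finite A"
  have "rev ` permutations_of_set A = permutations_of_set A"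
  proof (intro equalityI subsetI)
    fix xs assume "xs \<in> permutations_of_set A"
    then have "rev xs \<in> permutations_of_set A" by (simp add: permutations_of_set_def)
    then show "xs \<in> rev ` permutations_of_set A" by (metis image_eqI rev_rev_ident)
  qed (auto simp: permutations_of_set_def)
  then show ?thesis
    using A by (subst map_pmf_of_set_inj) auto
qed

text \<open>The last item of a random order of \<open>S\<close> is uniform in \<open>S\<close>, and
  given that item the others are in uniformly random order. All later estimates are inductions along
  this recursion.\<close>

lemma D_rec:
  assumes S: "finite S" "S \<noteq> {}"
  shows "D S = bind_pmf (pmf_of_set S) (\<lambda>j. bind_pmf (D (S - {j})) (alg_step S j))"
proof -
  let ?run = "\<lambda>\<sigma>. alg3_run U m a b orc 1 \<sigma> (\<lambda>_. 0) {}"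
  have "D S = bind_pmf (pmf_of_set (permutations_of_set S)) (\<lambda>\<sigma>. ?run (rev \<sigma>))"
    unfolding D_def by (subst rev_random_permutation[OF S(1), symmetric]) (simp add: bind_map_pmf)
  also have "\<dots> = bind_pmf (pmf_of_set S) (\<lambda>j.
      bind_pmf (pmf_of_set (permutations_of_set (S - {j}))) (\<lambda>\<sigma>. ?run (rev \<sigma> @ [j])))"
    using S by (subst random_permutation_of_set)
      (simp_all add: bind_assoc_pmf bind_return_pmf del: alg3_run.simps)
  also have "\<dots> = bind_pmf (pmf_of_set S) (\<lambda>j.
      bind_pmf (map_pmf rev (pmf_of_set (permutations_of_set (S - {j})))) (\<lambda>\<sigma>. ?run (\<sigma> @ [j])))"
    by (simp only: bind_map_pmf)
  also have "\<dots> = bind_pmf (pmf_of_set S) (\<lambda>j.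
      bind_pmf (pmf_of_set (permutations_of_set (S - {j}))) (\<lambda>\<sigma>. ?run (\<sigma> @ [j])))"
    using S by (simp only: rev_random_permutation finite_Diff)
  also have "\<dots> = bind_pmf (pmf_of_set S) (\<lambda>j. bind_pmf (D (S - {j})) (alg_step S j))"
  proof (intro bind_pmf_cong refl)
    fix j assume "j \<in> set_pmf (pmf_of_set S)"
    then have j: "j \<in> S" using S by simp
    have "bind_pmf (pmf_of_set (permutations_of_set (S - {j}))) (\<lambda>\<sigma>. ?run (\<sigma> @ [j]))
      = bind_pmf (pmf_of_set (permutations_of_set (S - {j}))) (\<lambda>\<sigma>. bind_pmf (?run \<sigma>) (alg_step S j))"
    proof (intro bind_pmf_cong refl)
      fix \<sigma> assume "\<sigma> \<in> set_pmf (pmf_of_set (permutations_of_set (S - {j})))"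
      then have "\<sigma> \<in> permutations_of_set (S - {j})"
        using S by (subst (asm) set_pmf_of_set) simp_all
      then have \<sigma>: "set \<sigma> = S - {j}" "distinct \<sigma>" by (simp_all add: permutations_of_set_def)
      then have "1 + length \<sigma> = card S"
        using card_Suc_Diff1[OF S(1) j] distinct_card[OF \<sigma>(2)] by simp
      then show "?run (\<sigma> @ [j]) = bind_pmf (?run \<sigma>) (alg_step S j)"
        unfolding alg3_run_snoc using \<sigma> j by (intro bind_pmf_cong refl alg3_run_single) auto
    qed
    then show "bind_pmf (pmf_of_set (permutations_of_set (S - {j}))) (\<lambda>\<sigma>. ?run (\<sigma> @ [j]))
      = bind_pmf (D (S - {j})) (alg_step S j)"
      by (simp only: D_def bind_assoc_pmf)
  qed
  finally show ?thesis .
qed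

lemma finite_D: "finite S \<Longrightarrow> finite (set_pmf (D S))"
proof (induction S rule: finite_psubset_induct)
  case (psubset S)
  show ?case
  proof (cases "S = {}")
    case False
    have "finite (set_pmf (D (S - {j})))" if "j \<in> S" for j
      using psubset.IH[of "S - {j}"] that by auto
    then show ?thesis
      unfolding D_rec[OF psubset.hyps(1) False] using False psubset.hyps(1)
      by (auto simp: alg_step_def)
  qed (simp add: D_empty)
qed

lemma D_support:
  assumes "S \<subseteq> U" "x \<in> set_pmf (D S)"
  shows "(\<forall>k. x k = 0 \<or> x k = 1) \<and> (\<forall>k. k \<notin> S \<longrightarrow> x k = 0) \<and> (\<forall>i<m. Ax U a x i \<le> b i)"
  using finite_subset[OF assms(1) finite_U] assms
proof (induction S arbitrary: x rule: finite_psubset_induct)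
  case (psubset S)
  show ?case
  proof (cases "S = {}")
    case True
    then show ?thesis using psubset.prems b_pos by (auto simp: D_empty Ax_def less_imp_le)
  next
    case False
    obtain j x' where j: "j \<in> S" "x' \<in> set_pmf (D (S - {j}))" and x: "x = x' \<or> x = add_item j x'"
      using psubset.prems psubset.hyps False by (subst (asm) D_rec)
        (auto simp: alg_step_def split: if_splits)
    have IH: "(\<forall>k. x' k = 0 \<or> x' k = 1) \<and> (\<forall>k. k \<notin> S - {j} \<longrightarrow> x' k = 0) \<and> (\<forall>i<m. Ax U a x' i \<le> b i)"
      using psubset.IH[of "S - {j}" x'] j psubset.prems by auto
    show ?thesis
    proof (cases "x = x'")
      case False
      then have "x = (\<lambda>k. x' k + indicator {j} k)" "fits j x'"
        using x by (auto simp: add_item_def split: if_splits)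
      \<comment> \<open>The old entry at \<open>j\<close> is 0, since \<open>x'\<close> vanishes
        outside \<open>S - {j}\<close>; so the new one is 1.\<close>
      then show ?thesis
        using IH j unfolding fits_def by (auto simp: indicator_def)
    qed (use IH in auto)
  qed
qed

lemma xt_mem:
  assumes "S \<subseteq> U" "S \<noteq> {}"
  shows "xt S \<in> scaled_poly U m a b (card S) S"
  unfolding xt_def using assms finite_U
  by (intro orc_mem) (auto simp: card_mono Suc_le_eq card_gt_0_iff finite_subset)

lemma xt_bounds:
  assumes "S \<subseteq> U" "S \<noteq> {}"
  shows "0 \<le> xt S j" "xt S j \<le> 1" "j \<notin> S \<Longrightarrow> xt S j = 0"
  using xt_mem[OF assms] by (cases "j \<in> U"; auto simp: scaled_poly_def unit_box_def)+

lemma E_rec: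
  assumes S: "S \<subseteq> U" "S \<noteq> {}"
  shows "real (card S) * E S \<phi> =
    (\<Sum>j\<in>S. xt S j * E (S - {j}) (\<lambda>x. \<phi> (add_item j x)) + (1 - xt S j) * E (S - {j}) \<phi>)"
proof -
  have fin: "finite S" using S finite_U finite_subset by blast
  have step: "measure_pmf.expectation (alg_step S j x) \<phi>
      = xt S j * \<phi> (add_item j x) + (1 - xt S j) * \<phi> x" for j x
    unfolding alg_step_def using xt_bounds[OF S]
    by (subst expectation_bind_finite) (auto simp: algebra_simps)
  have fstep: "finite (set_pmf (alg_step S j x))" for j x by (auto simp: alg_step_def)
  have one: "measure_pmf.expectation (bind_pmf (D (S - {j})) (alg_step S j)) \<phi>
     = xt S j * E (S - {j}) (\<lambda>x. \<phi> (add_item j x)) + (1 - xt S j) * E (S - {j}) \<phi>" for j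
    using finite_D[of "S - {j}"] fin fstep
    by (simp add: expectation_bind_finite step integrable_measure_pmf_finite)
  have "E S \<phi> = (\<Sum>j\<in>S. measure_pmf.expectation (bind_pmf (D (S - {j})) (alg_step S j)) \<phi>) / card S"
    using S fin fstep finite_D
    by (simp add: D_rec pmf_expectation_bind_pmf_of_set sum_distrib_left divide_inverse_commute)
  then show ?thesis using S fin by (simp add: one)
qed

lemma E_mono:
  "finite S \<Longrightarrow> (\<And>x. x \<in> set_pmf (D S) \<Longrightarrow> \<phi> x \<le> \<psi> x) \<Longrightarrow> E S \<phi> \<le> E S \<psi>"
  using finite_D by (rule expectation_mono_finite)

lemma E_integrable: "finite S \<Longrightarrow> integrable (measure_pmf (D S)) (\<phi> :: _ \<Rightarrow> real)"
  using finite_D by (rule integrable_measure_pmf_finite)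

subsection \<open>Probability of fitting\<close>

abbreviation "d \<equiv> real (col_sparsity U m a)"
abbreviation "B \<equiv> cap_ratio U m a b"
text \<open>The scale with \<open>q powr (B - 1) = 1 / d\<close>: a tail of order
  \<open>q powr (B - 1)\<close> survives a union bound over \<open>d\<close> rows.\<close>

definition q where "q = d powr (- 1 / (B - 1))"

definition \<mu> :: "nat \<Rightarrow> real" where "\<mu> i = Max ((\<lambda>j. a i j) ` U)"

lemma a_le_\<mu>: "j \<in> U \<Longrightarrow> a i j \<le> \<mu> i"
  using finite_U by (simp add: \<mu>_def)

lemma \<mu>_pos: assumes "i < m" shows "0 < \<mu> i"
proof -
  obtain j where "j \<in> U" "a i j \<noteq> 0" using row_nonzero[OF assms] by auto
  then show ?thesis using a_nonneg[OF assms, of j] a_le_\<mu>[of j i] by linarith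
qed

lemma B_le: "i < m \<Longrightarrow> B \<le> b i / \<mu> i"
  by (simp add: cap_ratio_def \<mu>_def)

lemma card_column_le: "j \<in> U \<Longrightarrow> real (card {i. i < m \<and> a i j \<noteq> 0}) \<le> d"
  using finite_U by (simp add: col_sparsity_def)

lemma d_ge_1: "1 \<le> d"
proof -
  obtain j where j: "j \<in> U" "a 0 j \<noteq> 0" using row_nonzero[OF m_pos] by auto
  then have "0 < card {i. i < m \<and> a i j \<noteq> 0}" using m_pos by (auto simp: card_gt_0_iff)
  then show ?thesis using card_column_le[OF j(1)] by linarith
qed

lemma q_bounds: "0 < q" "q \<le> 1"
proof -
  show "0 < q" using d_ge_1 by (simp add: q_def)
  show "q \<le> 1" unfolding q_def using d_ge_1 cap_ratio_ge powr_mono[of "- 1 / (B - 1)" 0 d] by simp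
qed

text \<open>Dividing by \<open>\<mu> i\<close> gives items of size at most 1. The induction
  hypothesis bounds the moment over \<open>S - {j}\<close> by the same \<open>M\<close> for every
  last item \<open>j\<close>, and a rejection only lowers the load, so no independence between
  rounds enters.\<close>

lemma mgf_bound:
  assumes S: "S \<subseteq> U" and i: "i < m" and c: "0 \<le> c"
  shows "E S (\<lambda>x. exp (c * (Ax U a x i / \<mu> i)))
    \<le> exp ((exp c - 1) * (b i / \<mu> i) * (real (card S) / real n))"
  using finite_subset[OF S finite_U] S
proof (induction S rule: finite_psubset_induct)
  case (psubset S)
  show ?case
  proof (cases "S = {}")
    case True
    then show ?thesis by (simp add: D_empty Ax_def)
  next
    case False
    define \<phi> where "\<phi> x = exp (c * (Ax U a x i / \<mu> i))" for x
    define M where "M = exp ((exp c - 1) * (b i / \<mu> i) * (real (card S - 1) / real n))"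
    have cS: "0 < card S" using False psubset by (simp add: card_gt_0_iff)
    have \<phi>_pos: "0 \<le> \<phi> x" for x by (simp add: \<phi>_def)
    have round: "xt S j * E (S - {j}) (\<lambda>x. \<phi> (add_item j x)) + (1 - xt S j) * E (S - {j}) \<phi>
      \<le> M * (1 + xt S j * (a i j / \<mu> i) * (exp c - 1))" if j: "j \<in> S" for j
    proof -
      have jU: "j \<in> U" using j psubset by auto
      define r where "r = a i j / \<mu> i"
      have r: "0 \<le> r" "r \<le> 1"
        using a_nonneg[OF i jU] a_le_\<mu>[OF jU, of i] \<mu>_pos[OF i] by (simp_all add: r_def)
      have add: "\<phi> (add_item j x) \<le> \<phi> x * (1 + r * (exp c - 1))" for x
      proof -
        have "\<phi> (add_item j x) \<le> \<phi> x * exp (c * r)"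
          using mult_nonneg_nonneg[OF c r(1)] Ax_add_indicator[OF finite_U jU, of a x i]
          by (auto simp: \<phi>_def add_item_def r_def exp_add[symmetric] algebra_simps add_divide_distrib)
        also have "\<dots> \<le> \<phi> x * (1 + r * (exp c - 1))"
          by (intro mult_left_mono exp_mult_le_linear r \<phi>_pos)
        finally show ?thesis .
      qed
      have IH: "E (S - {j}) \<phi> \<le> M"
      proof -
        have "S - {j} \<subset> S" "S - {j} \<subseteq> U" using j psubset.prems by auto
        from psubset.IH[OF this] show ?thesis using j by (simp add: \<phi>_def[abs_def] M_def)
      qed
      have xt: "0 \<le> xt S j" "xt S j \<le> 1" using xt_bounds[OF psubset.prems False] by auto
      have "E (S - {j}) (\<lambda>x. \<phi> (add_item j x)) \<le> E (S - {j}) (\<lambda>x. \<phi> x * (1 + r * (exp c - 1)))"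
        using psubset.hyps by (intro E_mono add) simp
      also have "\<dots> = E (S - {j}) \<phi> * (1 + r * (exp c - 1))" by simp
      finally have "xt S j * E (S - {j}) (\<lambda>x. \<phi> (add_item j x)) + (1 - xt S j) * E (S - {j}) \<phi>
        \<le> xt S j * (E (S - {j}) \<phi> * (1 + r * (exp c - 1))) + (1 - xt S j) * E (S - {j}) \<phi>"
        using xt by (simp add: mult_left_mono)
      also have "\<dots> = E (S - {j}) \<phi> * (1 + xt S j * r * (exp c - 1))" by (simp add: algebra_simps)
      also have "\<dots> \<le> M * (1 + xt S j * r * (exp c - 1))"
        using IH xt r c by (intro mult_right_mono) auto
      finally show ?thesis by (simp add: r_def)
    qed
    \<comment> \<open>The capacity in round \<open>card S\<close> is scaled by
      \<open>card S / n\<close>; averaging over the \<open>card S\<close> possible last items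
      cancels \<open>card S\<close>, so each round adds at most \<open>b i / n\<close> in
      expectation.\<close>
    have "(\<Sum>j\<in>S. a i j * xt S j) = Ax U a (xt S) i"
      unfolding Ax_def using finite_U psubset.prems xt_bounds[OF psubset.prems False]
      by (intro sum.mono_neutral_left) auto
    also have "\<dots> \<le> real (card S) / real n * b i"
      using xt_mem[OF psubset.prems False] i by (simp add: scaled_poly_def)
    finally have "(\<Sum>j\<in>S. a i j * xt S j) / \<mu> i \<le> real (card S) / real n * b i / \<mu> i"
      using \<mu>_pos[OF i] by (intro divide_right_mono) auto
    then have use: "(\<Sum>j\<in>S. xt S j * (a i j / \<mu> i)) \<le> real (card S) / real n * (b i / \<mu> i)"
      by (simp add: sum_divide_distrib mult.commute)
    have "real (card S) * E S \<phi> \<le> (\<Sum>j\<in>S. M * (1 + xt S j * (a i j / \<mu> i) * (exp c - 1)))"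
      unfolding E_rec[OF psubset.prems False] by (rule sum_mono[OF round])
    also have "\<dots> = M * (real (card S) + (\<Sum>j\<in>S. xt S j * (a i j / \<mu> i)) * (exp c - 1))"
      by (simp add: sum_distrib_left[symmetric] sum_distrib_right sum.distrib)
    also have "\<dots> \<le> M * (real (card S) + (real (card S) / real n * (b i / \<mu> i)) * (exp c - 1))"
      using use c by (intro mult_left_mono add_left_mono mult_right_mono) (auto simp: M_def)
    also have "\<dots> = real (card S) * (M * (1 + (exp c - 1) * (b i / \<mu> i) / real n))"
      by (simp add: algebra_simps)
    finally have "E S \<phi> \<le> M * (1 + (exp c - 1) * (b i / \<mu> i) / real n)"
      using cS by simp
    also have "\<dots> \<le> M * exp ((exp c - 1) * (b i / \<mu> i) / real n)"
      by (intro mult_left_mono exp_ge_add_one_self) (simp add: M_def)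
    also have "\<dots> = exp ((exp c - 1) * (b i / \<mu> i) * (real (card S) / real n))"
      using cS by (simp add: M_def exp_add[symmetric] of_nat_diff Suc_le_eq diff_divide_distrib algebra_simps)
    finally show ?thesis by (simp add: \<phi>_def[abs_def])
  qed
qed

text \<open>Chernoff bound for the load exceeding \<open>b i - \<mu> i\<close>; up to this threshold
  row \<open>i\<close> has room for any item.\<close>

lemma overload_prob:
  assumes S: "S \<subseteq> U" "real (card S) \<le> q / 12 * real n" and i: "i < m"
  shows "E S (\<lambda>x. of_bool (b i - \<mu> i < Ax U a x i)) \<le> 1 / (2 * d)"
proof -
  define \<beta> where "\<beta> = b i / \<mu> i"
  \<comment> \<open>Chosen so that \<open>exp c * (q / 12) = 1 / 2\<close>: the moment exponent is
    then at most \<open>\<beta> / 2\<close>, hence at most \<open>\<beta> - 1\<close> because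
    \<open>2 \<le> \<beta>\<close>.\<close>
  define c where "c = - ln (q / 6)"
  have \<beta>: "B \<le> \<beta>" "2 \<le> \<beta>" using B_le[OF i] cap_ratio_ge by (auto simp: \<beta>_def)
  have expc: "exp c = 6 / q" using q_bounds by (simp add: c_def exp_minus)
  have c: "0 \<le> c" using q_bounds by (simp add: c_def)
  have s: "real (card S) / real n \<le> q / 12" using S n_pos by (simp add: field_simps)
  have "E S (\<lambda>x. of_bool (b i - \<mu> i < Ax U a x i))
      \<le> E S (\<lambda>x. exp (- c * (\<beta> - 1)) * exp (c * (Ax U a x i / \<mu> i)))"
  proof (rule E_mono)
    fix x
    have "0 \<le> c * (Ax U a x i / \<mu> i - (\<beta> - 1))" if "b i - \<mu> i < Ax U a x i"
    proof -
      have "\<beta> - 1 \<le> Ax U a x i / \<mu> i"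
        using that \<mu>_pos[OF i] by (simp add: \<beta>_def pos_le_divide_eq left_diff_distrib)
      then show ?thesis using c by simp
    qed
    then show "of_bool (b i - \<mu> i < Ax U a x i) \<le> exp (- c * (\<beta> - 1)) * exp (c * (Ax U a x i / \<mu> i))"
      by (auto simp: exp_add[symmetric] algebra_simps)
  qed (use S finite_U finite_subset in blast)
  also have "\<dots> = exp (- c * (\<beta> - 1)) * E S (\<lambda>x. exp (c * (Ax U a x i / \<mu> i)))" by simp
  also have "\<dots> \<le> exp (- c * (\<beta> - 1)) * exp ((exp c - 1) * \<beta> * (real (card S) / real n))"
    using mgf_bound[OF S(1) i c] by (simp add: \<beta>_def)
  also have "\<dots> \<le> exp (- c * (\<beta> - 1)) * exp (\<beta> - 1)"
  proof -
    have "(exp c - 1) * \<beta> * (real (card S) / real n) \<le> (exp c * \<beta>) * (q / 12)"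
      using c \<beta> s q_bounds by (intro mult_mono) (auto simp: mult_right_mono)
    also have "\<dots> = \<beta> / 2" using q_bounds by (simp add: expc)
    also have "\<dots> \<le> \<beta> - 1" using \<beta> by simp
    finally show ?thesis by simp
  qed
  also have "\<dots> = exp ((1 - c) * (\<beta> - 1))" by (simp add: exp_add[symmetric] algebra_simps)
  also have "\<dots> \<le> exp ((ln q - ln 2) * (\<beta> - 1))"
  proof -
    have "1 \<le> ln (3::real)" using exp_le by (simp add: ln_ge_iff)
    moreover have "ln (6::real) = ln 2 + ln 3" using ln_mult[of 2 "3::real"] by simp
    ultimately have "1 - c \<le> ln q - ln 2" using q_bounds by (simp add: c_def ln_div)
    then show ?thesis using \<beta> by (simp add: mult_right_mono)
  qed
  \<comment> \<open>\<open>ln q - ln 2\<close> is negative, so the exponent grows when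
    \<open>\<beta>\<close> is lowered to \<open>B\<close>.\<close>
  also have "\<dots> \<le> exp ((ln q - ln 2) * (B - 1))"
  proof -
    have "ln q \<le> 0" "0 \<le> ln (2::real)" using q_bounds by auto
    then have "(ln q - ln 2) * (\<beta> - 1) \<le> (ln q - ln 2) * (B - 1)"
      using \<beta> by (intro mult_left_mono_neg) linarith+
    then show ?thesis by simp
  qed
  \<comment> \<open>The power of \<open>q\<close> gives exactly \<open>1 / d\<close>; the power of
    \<open>1 / 2\<close> is at most \<open>1 / 2\<close> since \<open>B - 1 \<ge> 1\<close>.\<close>
  also have "\<dots> \<le> exp (- ln (2 * d))"
  proof -
    have "ln q * (B - 1) = - ln d" using cap_ratio_ge d_ge_1 by (simp add: q_def ln_powr)
    moreover have "ln 2 \<le> ln 2 * (B - 1)" using cap_ratio_ge by simp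
    ultimately show ?thesis using d_ge_1 by (simp add: ln_mult algebra_simps)
  qed
  also have "\<dots> = 1 / (2 * d)" using d_ge_1 by (simp add: exp_minus inverse_eq_divide)
  finally show ?thesis .
qed

text \<open>Union bound over the rows that \<open>j\<close> uses, at most \<open>d\<close> of them
  with failure probability \<open>1 / (2 * d)\<close> each. The other rows stay feasible because
  \<open>j\<close> leaves their load unchanged.\<close>

lemma fits_prob:
  assumes S: "S \<subseteq> U" "real (card S) \<le> q / 12 * real n" and j: "j \<in> U"
  shows "1 / 2 \<le> E S (\<lambda>x. of_bool (fits j x))"
proof -
  let ?I = "{i. i < m \<and> a i j \<noteq> 0}"
  have finS: "finite S" using S finite_U finite_subset by blast
  have "(\<Sum>i\<in>?I. E S (\<lambda>x. of_bool (b i - \<mu> i < Ax U a x i))) \<le> (\<Sum>i\<in>?I. 1 / (2 * d))"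
    using S by (intro sum_mono overload_prob) auto
  also have "\<dots> = real (card ?I) * (1 / (2 * d))" by simp
  also have "\<dots> \<le> d * (1 / (2 * d))"
    using card_column_le[OF j] d_ge_1 by (intro mult_right_mono) auto
  also have "\<dots> = 1 / 2" using d_ge_1 by simp
  finally have "1 / 2 \<le> 1 - (\<Sum>i\<in>?I. E S (\<lambda>x. of_bool (b i - \<mu> i < Ax U a x i)))" by simp
  also have "\<dots> = E S (\<lambda>x. 1 - (\<Sum>i\<in>?I. of_bool (b i - \<mu> i < Ax U a x i)))"
    using E_integrable[OF finS] by (simp del: sum_of_bool_eq)
  also have "\<dots> \<le> E S (\<lambda>x. of_bool (fits j x))"
  proof (rule E_mono[OF finS])
    fix x assume x: "x \<in> set_pmf (D S)"
    show "1 - (\<Sum>i\<in>?I. of_bool (b i - \<mu> i < Ax U a x i)) \<le> (of_bool (fits j x) :: real)"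
    proof (cases "\<exists>i\<in>?I. b i - \<mu> i < Ax U a x i")
      case True
      then obtain i where i: "i \<in> ?I" "b i - \<mu> i < Ax U a x i" by auto
      have "(of_bool (b i - \<mu> i < Ax U a x i) :: real)
          \<le> (\<Sum>i\<in>?I. of_bool (b i - \<mu> i < Ax U a x i))"
        using i(1) by (intro member_le_sum) auto
      then show ?thesis using i(2) by simp
    next
      case False
      have "fits j x"
        unfolding fits_def
      proof (intro allI impI)
        fix i assume i: "i < m"
        show "Ax U a (\<lambda>k. x k + indicator {j} k) i \<le> b i"
        proof (cases "a i j = 0")
          case True
          then show ?thesis
            using D_support[OF S(1) x] i by (simp add: Ax_add_indicator[OF finite_U j])
        next
          case nz: False
          then have "Ax U a x i \<le> b i - \<mu> i" using False i by auto
          then show ?thesis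
            using a_le_\<mu>[OF j, of i] by (simp add: Ax_add_indicator[OF finite_U j])
        qed
      qed
      then show ?thesis by (simp add: sum_nonneg)
    qed
  qed
  finally show ?thesis .
qed

subsection \<open>Expected value\<close>

definition items :: "(nat \<Rightarrow> real) \<Rightarrow> nat set" where
  "items x = {k \<in> U. x k = 1}"

lemma items_subset: "items x \<subseteq> U" by (auto simp: items_def)

text \<open>The benchmark on the arrived items. \<open>z\<close> remains an arbitrary feasible
  point; the supremum is taken only at the end, so no maximiser has to be produced.\<close>

definition H :: "(nat \<Rightarrow> real) \<Rightarrow> nat set \<Rightarrow> real" where
  "H z S = F (\<lambda>k. if k \<in> S then z k else 0)"

lemma items_add_item:
  assumes "j \<in> U" "S \<subseteq> U" "x \<in> set_pmf (D S)" "j \<notin> S"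
  shows "items (add_item j x) = (if fits j x then insert j (items x) else items x)"
  using D_support[OF assms(2,3)] assms(1,4) by (auto simp: items_def add_item_def indicator_def)

lemma F_nonneg: "x \<in> unit_box U \<Longrightarrow> 0 \<le> F x"
  using multilinear_ext_mono[of U x "\<lambda>_. 0" f] f_nonneg finite_U
  by (simp add: unit_box_def multilinear_ext_const)

lemma F_bdd_above: "A \<subseteq> unit_box U \<Longrightarrow> bdd_above (F ` A)"
proof (rule bdd_aboveI2)
  fix x assume "A \<subseteq> unit_box U" "x \<in> A"
  then have "x \<in> unit_box U" by auto
  then show "F x \<le> f U"
    using multilinear_ext_mono[of U x f "\<lambda>_. f U"] monotone_set_fnD[OF f_mono, of _ U] finite_U
    by (simp add: unit_box_def multilinear_ext_const)
qed

lemma H_nonneg: "z \<in> unit_box U \<Longrightarrow> 0 \<le> H z S"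
  unfolding H_def by (rule F_nonneg) (auto simp: unit_box_def)

lemma H_removals:
  assumes "z \<in> unit_box U" "S \<subseteq> U"
  shows "(real (card S) - 1) * H z S \<le> (\<Sum>j\<in>S. H z (S - {j}))"
  unfolding H_def using assms f_nonneg
  by (intro multilinear_ext_restrict_removals finite_U f_submodular) (auto simp: unit_box_def)

text \<open>Restricting \<open>z\<close> to \<open>S\<close> keeps it feasible as \<open>a\<close>
  is nonnegative, and scaling by \<open>card S / n\<close> puts it into the polytope of the round.
  Concavity along the ray costs only that factor.\<close>

lemma F_xt_ge:
  assumes z: "z \<in> unit_box U" "\<And>i. i < m \<Longrightarrow> Ax U a z i \<le> b i"
    and S: "S \<subseteq> U" "S \<noteq> {}"
  shows "\<alpha> * (real (card S) / real n) * H z S \<le> F (xt S)"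
proof -
  define c where "c = real (card S) / real n"
  have cS: "1 \<le> card S" "card S \<le> n"
    using S finite_U by (auto simp: card_mono Suc_le_eq card_gt_0_iff finite_subset)
  have c: "0 \<le> c" "c \<le> 1" using cS n_pos by (auto simp: c_def)
  define zS where "zS = (\<lambda>k. if k \<in> S then z k else 0)"
  have zS: "zS \<in> unit_box U" using z by (auto simp: zS_def unit_box_def)
  have "Ax U a (\<lambda>k. c * zS k) i \<le> c * b i" if i: "i < m" for i
  proof -
    have "Ax U a zS i \<le> Ax U a z i"
      unfolding Ax_def zS_def using z(1) a_nonneg[OF i]
      by (intro sum_mono mult_left_mono) (auto simp: unit_box_def)
    then have "c * Ax U a zS i \<le> c * b i" using z(2)[OF i] c by (intro mult_left_mono) auto
    then show ?thesis by (simp add: Ax_def sum_distrib_left mult.left_commute)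
  qed
  then have mem: "(\<lambda>k. c * zS k) \<in> scaled_poly U m a b (card S) S"
    using zS c by (auto simp: scaled_poly_def c_def[symmetric] unit_box_def mult_le_one)
      (auto simp: zS_def)
  have "c * H z S \<le> c * F zS + (1 - c) * f {}"
    using c f_nonneg[of "{}"] by (simp add: H_def zS_def)
  also have "\<dots> \<le> F (\<lambda>k. c * zS k)"
    using zS by (intro multilinear_ext_scale finite_U f_submodular c) (auto simp: unit_box_def)
  also have "\<dots> \<le> Sup (F ` scaled_poly U m a b (card S) S)"
    using mem by (intro cSup_upper F_bdd_above) (auto simp: scaled_poly_def)
  finally have "\<alpha> * (c * H z S) \<le> \<alpha> * Sup (F ` scaled_poly U m a b (card S) S)"
    using \<alpha>_pos by simp
  also have "\<dots> \<le> F (xt S)"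
    unfolding xt_def using orc_approx[OF cS S(1)] .
  finally show ?thesis by (simp add: c_def mult.assoc)
qed

text \<open>\<open>T\<close> plays the role of the items accepted later. The sum is
  \<open>card S\<close> times the expected gain of tentatively adding the last item of
  \<open>S\<close> to \<open>T\<close>.\<close>

lemma xt_marginals:
  assumes S: "S \<subseteq> U" "S \<noteq> {}" and T: "T \<subseteq> U"
  shows "F (xt S) - f T \<le> (\<Sum>j\<in>S. xt S j * (f (insert j T) - f T))"
proof -
  have "F (xt S) \<le> f T + (\<Sum>j\<in>U. xt S j * (f (insert j T) - f T))"
    using xt_bounds[OF S] by (intro multilinear_ext_le_marginals finite_U f_mono f_submodular T) auto
  also have "(\<Sum>j\<in>U. xt S j * (f (insert j T) - f T)) = (\<Sum>j\<in>S. xt S j * (f (insert j T) - f T))"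
    using S finite_U xt_bounds[OF S] by (intro sum.mono_neutral_right) auto
  finally show ?thesis by simp
qed

text \<open>
  The gain of \<open>j\<close> is measured against the later items \<open>T\<close> only, not against the earlier items, with
  which \<open>j\<close> is correlated.
\<close>
lemma accept_gain:
  assumes S: "S \<subseteq> U" "real (card S) \<le> q / 12 * real n" and j: "j \<in> U" "j \<notin> S" and T: "T \<subseteq> U"
  shows "E S (\<lambda>x. f (items x \<union> insert j T)) + (f T - f (insert j T)) / 2
    \<le> E S (\<lambda>x. f (items (add_item j x) \<union> T))"
proof -
  define \<Delta> where "\<Delta> = f (insert j T) - f T"
  have finS: "finite S" using S finite_U finite_subset by blast
  note int = E_integrable[OF finS]
  have \<Delta>: "0 \<le> \<Delta>" using monotone_set_fnD[OF f_mono, of T "insert j T"] T j by (auto simp: \<Delta>_def)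
  \<comment> \<open>Acceptance loses nothing against taking \<open>j\<close> outright; rejection
    loses at most \<open>\<Delta>\<close> by submodularity. The expected loss is therefore at most
    \<open>\<Delta> / 2\<close>.\<close>
  have pt: "f (items x \<union> insert j T) - \<Delta> + \<Delta> * of_bool (fits j x) \<le> f (items (add_item j x) \<union> T)"
    if x: "x \<in> set_pmf (D S)" for x
  proof (cases "fits j x")
    case True
    then show ?thesis by (simp add: items_add_item[OF j(1) S(1) x j(2)])
  next
    case False
    have "f ((items x \<union> T) \<union> insert j T) + f ((items x \<union> T) \<inter> insert j T)
        \<le> f (items x \<union> T) + f (insert j T)"
      using T j items_subset by (intro submodular_set_fnD[OF f_submodular]) auto
    moreover have "f T \<le> f ((items x \<union> T) \<inter> insert j T)"
      using T items_subset j by (intro monotone_set_fnD[OF f_mono]) auto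
    moreover have "(items x \<union> T) \<union> insert j T = items x \<union> insert j T" by auto
    ultimately show ?thesis using False by (simp add: items_add_item[OF j(1) S(1) x j(2)] \<Delta>_def)
  qed
  have "E S (\<lambda>x. f (items x \<union> insert j T)) - \<Delta> + \<Delta> * (1 / 2)
      \<le> E S (\<lambda>x. f (items x \<union> insert j T)) - \<Delta> + \<Delta> * E S (\<lambda>x. of_bool (fits j x))"
    using fits_prob[OF S j(1)] \<Delta> by (intro add_left_mono mult_left_mono)
  also have "\<dots> = E S (\<lambda>x. f (items x \<union> insert j T) - \<Delta> + \<Delta> * of_bool (fits j x))"
    using int by simp
  also have "\<dots> \<le> E S (\<lambda>x. f (items (add_item j x) \<union> T))"
    by (rule E_mono[OF finS pt])
  finally show ?thesis by (simp add: \<Delta>_def algebra_simps diff_divide_distrib)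
qed

text \<open>
  The coefficients solve the recursions \<open>v\<^sub>l = (1 - 1/l) v\<^sub>l\<^sub>-\<^sub>1\<close> and
  \<open>u\<^sub>l = (1 - 1/l) u\<^sub>l\<^sub>-\<^sub>1 + v\<^sub>l\<^sub>-\<^sub>1 / n\<close> (the latter up to an inequality) started at \<open>l = K\<close>; rounds
  before \<open>K\<close> are ignored, because the factor \<open>1 - 1/l\<close> vanishes at \<open>l = 1\<close>.
\<close>
lemma expected_value_ge:
  assumes z: "z \<in> unit_box U" "\<And>i. i < m \<Longrightarrow> Ax U a z i \<le> b i"
    and K: "1 \<le> K" "K \<le> card S" and S: "S \<subseteq> U" "real (card S) \<le> q / 12 * real n" and T: "T \<subseteq> U"
  shows "f T / 2 + (\<alpha> * (real K * (real (card S) - real K) / (real (card S) * real n)) * H z S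
        + real K / real (card S) * f T) / 2
    \<le> E S (\<lambda>x. f (items x \<union> T))"
  using K(2) S T
proof (induction "card S - K" arbitrary: S T)
  \<comment> \<open>At \<open>card S = K\<close> the first coefficient is 0 and the second is 1, so
    the bound reads \<open>f T\<close>, which monotonicity provides.\<close>
  case 0
  have finS: "finite S" using 0 finite_U finite_subset by blast
  have "f T = E S (\<lambda>x. f T)" by simp
  also have "\<dots> \<le> E S (\<lambda>x. f (items x \<union> T))"
    using 0 items_subset by (intro E_mono finS monotone_set_fnD[OF f_mono]) auto
  finally show ?case using 0 K by simp
next
  case (Suc r)
  define l where "l = real (card S) - 1"
  define u where "u = \<alpha> * (real K * (l - real K) / (l * real n))"
  define v where "v = real K / l"
  have finS: "finite S" using Suc finite_U finite_subset by blast
  have cS: "K < card S" and Sne: "S \<noteq> {}" using Suc.hyps(2) by auto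
  have l: "real K \<le> l" "0 < l" using cS K by (auto simp: l_def)
  have card_rem: "real (card (S - {j})) = l" if "j \<in> S" for j
    using card_Suc_Diff1[OF finS that] by (simp add: l_def)
  have IH: "f T' / 2 + (u * H z (S - {j}) + v * f T') / 2 \<le> E (S - {j}) (\<lambda>x. f (items x \<union> T'))"
    if j: "j \<in> S" and T': "T' \<subseteq> U" for j T'
  proof -
    have "card (S - {j}) = card S - 1" using j finS by simp
    then have "r = card (S - {j}) - K" "K \<le> card (S - {j})" using Suc.hyps(2) cS by simp_all
    moreover have "S - {j} \<subseteq> U" "real (card (S - {j})) \<le> q / 12 * real n"
      using Suc.prems card_rem[OF j] by (auto simp: l_def)
    ultimately show ?thesis
      using Suc.hyps(1)[of "S - {j}" T'] T' unfolding card_rem[OF j] u_def v_def by blast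
  qed
  have round: "f T / 2 + (u * H z (S - {j}) + v * (f T + xt S j * (f (insert j T) - f T))) / 2
    \<le> xt S j * E (S - {j}) (\<lambda>x. f (items (add_item j x) \<union> T))
      + (1 - xt S j) * E (S - {j}) (\<lambda>x. f (items x \<union> T))" if j: "j \<in> S" for j
  proof -
    have jU: "j \<in> U" using j Suc.prems by auto
    have xt: "0 \<le> xt S j" "xt S j \<le> 1" using xt_bounds[OF Suc.prems(2) Sne] by auto
    \<comment> \<open>The leading half of \<open>f (insert j T)\<close> in the induction hypothesis
      pays for the possible rejection of \<open>j\<close> and leaves \<open>f T / 2\<close>. This is
      why the claim carries that term.\<close>
    have "f T / 2 + (u * H z (S - {j}) + v * f (insert j T)) / 2
        \<le> E (S - {j}) (\<lambda>x. f (items x \<union> insert j T)) + (f T - f (insert j T)) / 2"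
      using IH[OF j, of "insert j T"] jU Suc.prems(4) by (simp add: field_simps)
    also have "\<dots> \<le> E (S - {j}) (\<lambda>x. f (items (add_item j x) \<union> T))"
      using Suc.prems card_rem[OF j] jU by (intro accept_gain) (auto simp: l_def)
    finally have "xt S j * (f T / 2 + (u * H z (S - {j}) + v * f (insert j T)) / 2)
          + (1 - xt S j) * (f T / 2 + (u * H z (S - {j}) + v * f T) / 2)
        \<le> xt S j * E (S - {j}) (\<lambda>x. f (items (add_item j x) \<union> T))
          + (1 - xt S j) * E (S - {j}) (\<lambda>x. f (items x \<union> T))"
      using xt IH[OF j Suc.prems(4)] by (intro add_mono mult_left_mono) auto
    then show ?thesis by (simp add: algebra_simps add_divide_distrib diff_divide_distrib)
  qed
  have u0: "0 \<le> u" and v0: "0 \<le> v" using l \<alpha>_pos by (simp_all add: u_def v_def)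
  have Hrem: "l * H z S \<le> (\<Sum>j\<in>S. H z (S - {j}))"
    using H_removals[OF z(1) Suc.prems(2)] by (simp add: l_def)
  have marg: "\<alpha> * ((l + 1) / real n) * H z S - f T \<le> (\<Sum>j\<in>S. xt S j * (f (insert j T) - f T))"
    using F_xt_ge[OF z Suc.prems(2) Sne] xt_marginals[OF Suc.prems(2) Sne Suc.prems(4)]
    by (simp add: l_def)
  \<comment> \<open>Verification of the recursion for the coefficients; the slack comes from
    \<open>v * (l + 1) = K + K / l\<close>.\<close>
  have "(l + 1) * (f T / 2) + (\<alpha> * (real K * (l + 1 - real K) / real n) * H z S + real K * f T) / 2
    \<le> (l + 1) * (f T / 2) + (u * (l * H z S) + v * ((l + 1) * f T
        + (\<alpha> * ((l + 1) / real n) * H z S - f T))) / 2"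
  proof -
    have ul: "u * l = \<alpha> * (real K * (l - real K) / real n)" using l by (simp add: u_def)
    have vl: "v * l = real K" using l by (simp add: v_def)
    have "real K \<le> v * (l + 1)" using l v0 by (simp add: distrib_left v_def)
    then have "\<alpha> / real n * H z S * real K \<le> \<alpha> / real n * H z S * (v * (l + 1))"
      using \<alpha>_pos H_nonneg[OF z(1)] by (intro mult_left_mono) auto
    moreover have "\<alpha> * (real K * (l + 1 - real K) / real n) * H z S
        = \<alpha> * (real K * (l - real K) / real n) * H z S + \<alpha> / real n * H z S * real K"
      by (simp add: algebra_simps add_divide_distrib diff_divide_distrib)
    ultimately have "\<alpha> * (real K * (l + 1 - real K) / real n) * H z S + real K * f T
      \<le> (u * l) * H z S + v * l * f T + \<alpha> / real n * H z S * (v * (l + 1))"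
      unfolding ul vl by linarith
    also have "\<dots> = u * (l * H z S) + v * ((l + 1) * f T + (\<alpha> * ((l + 1) / real n) * H z S - f T))"
      by (simp add: algebra_simps add_divide_distrib)
    finally show ?thesis by (intro add_left_mono divide_right_mono) auto
  qed
  also have "\<dots> \<le> (l + 1) * (f T / 2) + (u * (\<Sum>j\<in>S. H z (S - {j})) + v * ((l + 1) * f T
        + (\<Sum>j\<in>S. xt S j * (f (insert j T) - f T)))) / 2"
    using Hrem marg u0 v0 by (intro add_left_mono divide_right_mono add_mono mult_left_mono) auto
  also have "\<dots> = (\<Sum>j\<in>S. f T / 2
      + (u * H z (S - {j}) + v * (f T + xt S j * (f (insert j T) - f T))) / 2)"
    by (simp add: sum.distrib sum_divide_distrib[symmetric] sum_distrib_left[symmetric] l_def)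
  also have "\<dots> \<le> real (card S) * E S (\<lambda>x. f (items x \<union> T))"
    unfolding E_rec[OF Suc.prems(2) Sne] by (rule sum_mono[OF round])
  also have "(l + 1) * (f T / 2) + (\<alpha> * (real K * (l + 1 - real K) / real n) * H z S + real K * f T) / 2
      = real (card S) * (f T / 2 + (\<alpha> * (real K * (real (card S) - real K) / (real (card S) * real n))
          * H z S + real K / real (card S) * f T) / 2)"
    using cS n_pos by (simp add: l_def field_simps)
  finally show ?case using cS by (simp add: mult_le_cancel_left)
qed

text \<open>After round \<open>2 * K\<close> monotonicity keeps the value from dropping, while going
  back from round \<open>l\<close> preserves on average a fraction \<open>1 - 1 / l\<close> of the
  benchmark. So \<open>card S\<close> times the value stays above a fixed multiple of the
  benchmark.\<close>

lemma E_growth: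
  assumes z: "z \<in> unit_box U" "\<And>i. i < m \<Longrightarrow> Ax U a z i \<le> b i"
    and K: "1 \<le> K" "2 * K \<le> card S" "real (2 * K) \<le> q / 12 * real n" and S: "S \<subseteq> U"
  shows "\<alpha> * real K ^ 2 / (2 * real n) * H z S \<le> real (card S) * E S (\<lambda>x. f (items x))"
  using K(2) S
proof (induction "card S - 2 * K" arbitrary: S)
  case 0
  then have cS: "real (card S) = 2 * real K" by simp
  \<comment> \<open>Applied with no later items. Stopping at \<open>2 * K\<close> balances the
    product \<open>K * (card S - K)\<close>.\<close>
  have "\<alpha> * (real K * (real (card S) - real K) / (real (card S) * real n)) * H z S / 2
      \<le> E S (\<lambda>x. f (items x))"
  proof -
    have "f {} / 2 + (\<alpha> * (real K * (real (card S) - real K) / (real (card S) * real n)) * H z S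
        + real K / real (card S) * f {}) / 2 \<le> E S (\<lambda>x. f (items x \<union> {}))"
      using 0 K cS by (intro expected_value_ge z) auto
    moreover have "0 \<le> f {}" "0 \<le> real K / real (card S) * f {}" using f_nonneg by simp_all
    moreover have "X / 2 \<le> e" if "r / 2 + (X + Y) / 2 \<le> e" "0 \<le> r" "0 \<le> Y" for r X Y e :: real
      using that by (simp add: field_simps)
    ultimately show ?thesis by (simp only: Un_empty_right)
  qed
  then have "real (card S) * (\<alpha> * (real K * (real (card S) - real K) / (real (card S) * real n)) * H z S / 2)
      \<le> real (card S) * E S (\<lambda>x. f (items x))"
    by (intro mult_left_mono) auto
  then show ?case using K by (simp add: cS power2_eq_square field_simps)
next
  case (Suc r)
  define w where "w = \<alpha> * real K ^ 2 / (2 * real n)"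
  have finS: "finite S" using Suc finite_U finite_subset by blast
  have cS: "2 * K < card S" and Sne: "S \<noteq> {}" using Suc.hyps(2) by auto
  have card_rem: "card (S - {j}) = card S - 1" if "j \<in> S" for j using that finS by simp
  have l: "0 < real (card S) - 1" using cS K by simp
  have round: "w * H z (S - {j}) / (real (card S) - 1)
    \<le> xt S j * E (S - {j}) (\<lambda>x. f (items (add_item j x))) + (1 - xt S j) * E (S - {j}) (\<lambda>x. f (items x))"
    if j: "j \<in> S" for j
  proof -
    let ?E = "E (S - {j}) (\<lambda>x. f (items x))"
    have jU: "j \<in> U" and Sj: "S - {j} \<subseteq> U" using j Suc.prems by auto
    have "w * H z (S - {j}) \<le> real (card (S - {j})) * ?E"
      unfolding w_def using Suc.hyps Suc.prems cS card_rem[OF j] by (intro Suc.hyps(1)) auto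
    then have IH: "w * H z (S - {j}) / (real (card S) - 1) \<le> ?E"
      using l card_rem[OF j] cS by (simp add: of_nat_diff pos_divide_le_eq mult.commute)
    have "?E \<le> E (S - {j}) (\<lambda>x. f (items (add_item j x)))"
    proof (rule E_mono)
      fix x assume x: "x \<in> set_pmf (D (S - {j}))"
      show "f (items x) \<le> f (items (add_item j x))"
        using items_subset jU items_add_item[OF jU Sj x]
        by (intro monotone_set_fnD[OF f_mono]) auto
    qed (use finS in simp)
    then have "xt S j * ?E \<le> xt S j * E (S - {j}) (\<lambda>x. f (items (add_item j x)))"
      using xt_bounds[OF Suc.prems(2) Sne] by (intro mult_left_mono) auto
    then show ?thesis using IH by (simp add: algebra_simps)
  qed
  have "w * H z S = w / (real (card S) - 1) * ((real (card S) - 1) * H z S)" using l by simp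
  also have "\<dots> \<le> w / (real (card S) - 1) * (\<Sum>j\<in>S. H z (S - {j}))"
    using H_removals[OF z(1) Suc.prems(2)] l \<alpha>_pos by (intro mult_left_mono) (auto simp: w_def)
  also have "\<dots> = (\<Sum>j\<in>S. w * H z (S - {j}) / (real (card S) - 1))"
    by (simp add: sum_distrib_left)
  also have "\<dots> \<le> real (card S) * E S (\<lambda>x. f (items x))"
    unfolding E_rec[OF Suc.prems(2) Sne] by (rule sum_mono[OF round])
  finally show ?case by (simp add: w_def)
qed

section \<open>Comparison with the fractional optimum\<close>

lemma opt_frac_nonneg: "0 \<le> opt_frac U f m a b"
proof -
  have "(\<lambda>_. 0) \<in> {x \<in> unit_box U. \<forall>i<m. Ax U a x i \<le> b i}"
    using b_pos by (auto simp: unit_box_def Ax_def less_imp_le)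
  then have "F (\<lambda>_. 0) \<le> opt_frac U f m a b"
    unfolding opt_frac_def by (intro cSup_upper F_bdd_above) auto
  moreover have "0 \<le> F (\<lambda>_. 0)" by (rule F_nonneg) (auto simp: unit_box_def)
  ultimately show ?thesis by linarith
qed

lemma opt_frac_le:
  assumes "\<And>z. z \<in> unit_box U \<Longrightarrow> (\<And>i. i < m \<Longrightarrow> Ax U a z i \<le> b i) \<Longrightarrow> F z \<le> C"
  shows "opt_frac U f m a b \<le> C"
proof -
  have "(\<lambda>_. 0) \<in> {x \<in> unit_box U. \<forall>i<m. Ax U a x i \<le> b i}"
    using b_pos by (auto simp: unit_box_def Ax_def less_imp_le)
  then show ?thesis unfolding opt_frac_def using assms by (intro cSup_least) blast+
qed

lemma alg3_eq_D: "alg3 U m a b orc = D U"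
  by (simp add: alg3_def D_def)

lemma alg3_value:
  assumes "\<alpha> \<le> 1"
  shows "(1 / 20000 * \<alpha> * d powr (- 2 / (B - 1)) - 1 / real n ^ 2) * opt_frac U f m a b
    \<le> measure_pmf.expectation (alg3 U m a b orc) F"
proof -
  define \<delta> where "\<delta> = q / 12"
  define K where "K = nat \<lfloor>\<delta> * real n / 2\<rfloor>"
  define V where "V = E U (\<lambda>x. f (items x))"
  have \<delta>: "0 < \<delta>" using q_bounds by (simp add: \<delta>_def)
  have VE: "measure_pmf.expectation (alg3 U m a b orc) F = V"
    unfolding V_def alg3_eq_D items_def using D_support[of U]
    by (intro integral_cong_AE) (auto simp: AE_measure_pmf_iff multilinear_ext_zero_one finite_U)
  have V0: "0 \<le> V" unfolding V_def using f_nonneg items_subset by simp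
  have "d powr (- 2 / (B - 1)) = q ^ 2"
    using d_ge_1 by (simp add: q_def powr_numeral[symmetric] powr_powr)
  \<comment> \<open>Here \<open>\<delta>^2 / 128 = q^2 / 18432\<close>, and
    \<open>18432 \<le> 20000\<close>.\<close>
  then have rate: "1 / 20000 * \<alpha> * d powr (- 2 / (B - 1)) \<le> \<alpha> * \<delta> ^ 2 / 128"
    using \<alpha>_pos by (simp add: \<delta>_def power_divide)
  have K: "real K \<le> \<delta> * real n / 2" "\<delta> * real n / 2 < real K + 1"
  proof -
    have "real K = of_int \<lfloor>\<delta> * real n / 2\<rfloor>" using \<delta> by (simp add: K_def)
    then show "real K \<le> \<delta> * real n / 2" "\<delta> * real n / 2 < real K + 1"
      using floor_correct[of "\<delta> * real n / 2"] by simp_all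
  qed
  show ?thesis
  proof (cases "K = 0")
    case True
    then have "(\<delta> * real n) ^ 2 \<le> 2 ^ 2" using K \<delta> by (intro power_mono) auto
    then have "\<delta> ^ 2 / 128 \<le> 1 / real n ^ 2" using n_pos by (simp add: field_simps power_mult_distrib)
    moreover have "\<alpha> * (\<delta> ^ 2 / 128) \<le> 1 * (\<delta> ^ 2 / 128)" using assms by (intro mult_right_mono) auto
    ultimately have "1 / 20000 * \<alpha> * d powr (- 2 / (B - 1)) - 1 / real n ^ 2 \<le> 0" using rate by simp
    then have "(1 / 20000 * \<alpha> * d powr (- 2 / (B - 1)) - 1 / real n ^ 2) * opt_frac U f m a b \<le> 0"
      using opt_frac_nonneg by (rule mult_nonpos_nonneg)
    then show ?thesis using V0 VE by simp
  next
    case False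
    then have K1: "1 \<le> K" by simp
    have 2: "real (2 * K) \<le> q / 12 * real n" using K by (simp add: \<delta>_def)
    also have "\<dots> \<le> 1 * real n" using q_bounds by (intro mult_right_mono) auto
    finally have Kn: "2 * K \<le> n" by simp
    \<comment> \<open>For \<open>K \<ge> 1\<close> rounding down costs at most a factor 2:
      \<open>\<delta> * n / 2 < K + 1 \<le> 2 * K\<close>.\<close>
    have "\<delta> * real n / 4 \<le> real K" using K K1 by simp
    then have "(\<delta> * real n / 4) ^ 2 \<le> real K ^ 2" using \<delta> by (intro power_mono) auto
    then have K2: "\<delta> ^ 2 / 32 * real n ^ 2 \<le> real K ^ 2 / 2"
      by (simp add: power_mult_distrib power_divide)
    have val: "\<alpha> * \<delta> ^ 2 / 32 * F z \<le> V"
      if z: "z \<in> unit_box U" "\<And>i. i < m \<Longrightarrow> Ax U a z i \<le> b i" for z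
    proof -
      have HU: "H z U = F z"
        unfolding H_def by (rule arg_cong[of _ _ F]) (use z in \<open>auto simp: unit_box_def\<close>)
      have "\<alpha> * F z * (\<delta> ^ 2 / 32 * real n ^ 2) \<le> \<alpha> * F z * (real K ^ 2 / 2)"
        using K2 \<alpha>_pos F_nonneg[OF z(1)] by (intro mult_left_mono) auto
      moreover have "\<alpha> * real K ^ 2 / (2 * real n) * F z \<le> real n * V"
        using E_growth[OF z K1 Kn 2 subset_refl] by (simp add: HU V_def)
      then have "\<alpha> * F z * (real K ^ 2 / 2) \<le> V * real n ^ 2"
        using n_pos by (simp add: field_simps power2_eq_square)
      ultimately have "(\<alpha> * \<delta> ^ 2 / 32 * F z) * real n ^ 2 \<le> V * real n ^ 2"
        by (simp add: mult_ac)
      then show ?thesis using n_pos by (simp add: mult_le_cancel_right)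
    qed
    have "0 < \<alpha> * \<delta> ^ 2 / 32" using \<alpha>_pos \<delta> by simp
    then have "opt_frac U f m a b \<le> V / (\<alpha> * \<delta> ^ 2 / 32)"
      using val by (intro opt_frac_le) (simp add: pos_le_divide_eq mult.commute)
    then have opt: "\<alpha> * \<delta> ^ 2 / 32 * opt_frac U f m a b \<le> V"
      using \<open>0 < \<alpha> * \<delta> ^ 2 / 32\<close> by (simp add: pos_le_divide_eq mult.commute)
    have "1 / 20000 * \<alpha> * d powr (- 2 / (B - 1)) - 1 / real n ^ 2 \<le> \<alpha> * \<delta> ^ 2 / 32"
    proof -
      have "0 \<le> \<alpha> * \<delta> ^ 2" "0 \<le> 1 / real n ^ 2" using \<alpha>_pos by simp_all
      then show ?thesis using rate by linarith
    qed
    then have "(1 / 20000 * \<alpha> * d powr (- 2 / (B - 1)) - 1 / real n ^ 2) * opt_frac U f m a b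
        \<le> \<alpha> * \<delta> ^ 2 / 32 * opt_frac U f m a b"
      using opt_frac_nonneg by (rule mult_right_mono)
    then show ?thesis using opt unfolding VE by (rule order_trans)
  qed
qed

end

theorem mainTheorem14:
  shows "\<exists>c0 > (0::real). \<exists>g :: nat \<Rightarrow> real. g \<longlonglongrightarrow> 0 \<and>
    (\<forall>(U::nat set) (m::nat) (a::nat \<Rightarrow> nat \<Rightarrow> real) (b::nat \<Rightarrow> real) (f::nat set \<Rightarrow> real)
       (\<alpha>::real) (orc::(nat \<Rightarrow> real) set \<Rightarrow> (nat \<Rightarrow> real)).
       finite U \<and> U \<noteq> {} \<and> 0 < m
       \<and> (\<forall>i<m. \<forall>j\<in>U. 0 \<le> a i j \<and> a i j \<le> 1)
       \<and> (\<forall>i<m. \<exists>j\<in>U. a i j \<noteq> 0)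
       \<and> (\<forall>i<m. 0 < b i)
       \<and> (\<forall>S\<subseteq>U. 0 \<le> f S) \<and> monotone_set_fn U f \<and> submodular_set_fn U f
       \<and> 0 < \<alpha> \<and> \<alpha> \<le> 1
       \<and> (\<forall>l S. 1 \<le> l \<and> l \<le> card U \<and> S \<subseteq> U \<longrightarrow>
             orc (scaled_poly U m a b l S) \<in> scaled_poly U m a b l S
           \<and> multilinear_ext U f (orc (scaled_poly U m a b l S))
               \<ge> \<alpha> * Sup (multilinear_ext U f ` scaled_poly U m a b l S))
       \<and> cap_ratio U m a b \<ge> 2
       \<longrightarrow>
       (\<forall>y \<in> set_pmf (alg3 U m a b orc).
           (\<forall>j\<in>U. y j = 0 \<or> y j = 1) \<and> (\<forall>j. j \<notin> U \<longrightarrow> y j = 0)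
         \<and> (\<forall>i<m. Ax U a y i \<le> b i))
       \<and> measure_pmf.expectation (alg3 U m a b orc) (multilinear_ext U f)
           \<ge> (c0 * \<alpha> * real (col_sparsity U m a) powr (- 2 / (cap_ratio U m a b - 1))
               - g (card U)) * opt_frac U f m a b)"
proof (rule exI[of _ "1 / 20000"], intro conjI exI[of _ "\<lambda>n. 1 / real n ^ 2"] allI impI)
  show "(\<lambda>n. 1 / real n ^ 2) \<longlonglongrightarrow> 0" by real_asymp
next
  fix U m a b f \<alpha> orc
  assume *: "finite U \<and> U \<noteq> {} \<and> 0 < m
       \<and> (\<forall>i<m. \<forall>j\<in>U. 0 \<le> a i j \<and> a i j \<le> 1)
       \<and> (\<forall>i<m. \<exists>j\<in>U. a i j \<noteq> 0)
       \<and> (\<forall>i<m. 0 < b i)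
       \<and> (\<forall>S\<subseteq>U. 0 \<le> f S) \<and> monotone_set_fn U f \<and> submodular_set_fn U f
       \<and> 0 < \<alpha> \<and> \<alpha> \<le> 1
       \<and> (\<forall>l S. 1 \<le> l \<and> l \<le> card U \<and> S \<subseteq> U \<longrightarrow>
             orc (scaled_poly U m a b l S) \<in> scaled_poly U m a b l S
           \<and> multilinear_ext U f (orc (scaled_poly U m a b l S))
               \<ge> \<alpha> * Sup (multilinear_ext U f ` scaled_poly U m a b l S))
       \<and> cap_ratio U m a b \<ge> 2"
  then interpret online_packing U m a b f \<alpha> orc
    by unfold_locales auto
  show "\<forall>y \<in> set_pmf (alg3 U m a b orc).
           (\<forall>j\<in>U. y j = 0 \<or> y j = 1) \<and> (\<forall>j. j \<notin> U \<longrightarrow> y j = 0)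
         \<and> (\<forall>i<m. Ax U a y i \<le> b i)"
    using D_support[of U] by (auto simp: alg3_eq_D)
  show "measure_pmf.expectation (alg3 U m a b orc) (multilinear_ext U f)
           \<ge> (1 / 20000 * \<alpha> * real (col_sparsity U m a) powr (- 2 / (cap_ratio U m a b - 1))
               - 1 / real (card U) ^ 2) * opt_frac U f m a b"
    using * by (intro alg3_value) auto
qed simp

end
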